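(* Let $N\ge 2$ and let $\mathscr{T}_{LR}=\mathscr{M}_l+\mathscr{A}_l+\mathscr{M}_r+\mathscr{A}_r$ be the substructured operator of the $N$-strip domain decomposition of the Helmholtz problem in left-right numbering, with $C_r=(I-\mathscr{M}_r)^{-1}\mathscr{A}_r$ and $C_l=(I-\mathscr{M}_l)^{-1}\mathscr{A}_l$. Let $$M^{-1}_{SGS}:=(I-\mathscr{M}_r-\mathscr{A}_r)^{-1}(I-\mathscr{M}_l-\mathscr{A}_l)^{-1}$$ be the Symmetric Gauss-Seidel preconditioner (of the subdomain-wise numbering, expressed in the left-right numbering) for the operator $I-\mathscr{T}_{LR}$, and let $R_{SGS}:=M_{SGS}^{-1}\bigl(M_{SGS}-(I-\mathscr{T}_{LR})\bigr)$ be its error propagation operator. Then $$R_{SGS}=(I+C_r)\,C_l\,(\mathscr{M}_r+\mathscr{A}_r),$$ and for every integer $n\ge 1$, $$R_{SGS}^n=(I+C_r)\,C_l\,(C_r\,C_l)^{n-1}\,(\mathscr{M}_r+\mathscr{A}_r).$$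
   Context: Setting. A bounded domain $\Omega\subset\mathbb{R}^2$ is decomposed into $N\ge 2$ successive strips $\Omega_1,\dots,\Omega_N$ (with or without overlap). The part of $\partial\Omega_i\setminus\partial\Omega$ on the left (right) of $\Omega_i$ is the interface $\Gamma_{i,l}$ ($\Gamma_{i,r}$); $\Gamma_{1,l}=\Gamma_{N,r}=\emptyset$. Linear interface operators $\mathcal{B}_{i,l}$ ($2\le i\le N$) and $\mathcal{B}_{i,r}$ ($1\le i\le N-1$) are given, with traces taken on $\Gamma_{i,l}$ and $\Gamma_{i,r}$. For interface functions $h_l,h_r$ and a source $f$, $S_i(h_l,h_r,f)$ denotes the solution $v$ of $(-k^2-\Delta)v=f$ in $\Omega_i$, $\mathcal{B}_{i,l}(v)=h_l$ on $\Gamma_{i,l}$ (if $i\ge2$), $\mathcal{B}_{i,r}(v)=h_r$ on $\Gamma_{i,r}$ (if $i\le N-1$), with fixed linear homogeneous boundary conditions on $\partial\Omega\cap\partial\Omega_i$; these local problems are assumed well posed, so that $S_i$ is linear (for $i=1$ the argument $h_l$ is ignored, for $i=N$ the argument $h_r$ is ignored). Substructured operator. The unknowns are interface functions ordered in the left-right (LR) numbering $(h_{2,l},h_{3,l},\dots,h_{N,l},h_{N-1,r},h_{N-2,r},\dots,h_{1,r})$, i.e. $2N-2$ components. $\mathscr{T}_{LR}$ is the $(2N-2)\times(2N-2)$ matrix of linear operators whose only possibly nonzero entries (row index first, column index second) are $\mathscr{T}_{(i+1,l)(i,l)}=\mathcal{B}_{i+1,l}(S_i(\cdot,0,0))$ for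 $2\le i\le N-1$; $\mathscr{T}_{(i+1,l)(i,r)}=\mathcal{B}_{i+1,l}(S_i(0,\cdot,0))$ for $1\le i\le N-1$; $\mathscr{T}_{(i-1,r)(i,r)}=\mathcal{B}_{i-1,r}(S_i(0,\cdot,0))$ for $2\le i\le N-1$; $\mathscr{T}_{(i-1,r)(i,l)}=\mathcal{B}_{i-1,r}(S_i(\cdot,0,0))$ for $2\le i\le N$. Submatrices. $I$ is the identity. Let $I_l$ (resp. $I_r$) be the diagonal $(2N-2)\times(2N-2)$ matrix with diagonal entries $1$ in positions $1,\dots,N-1$ (resp. $N,\dots,2N-2$) and $0$ elsewhere. Set $\mathscr{M}_l:=I_l^T\mathscr{T}_{LR}I_l$, $\mathscr{A}_l:=I_l^T\mathscr{T}_{LR}I_r$, $\mathscr{A}_r:=I_r^T\mathscr{T}_{LR}I_l$, $\mathscr{M}_r:=I_r^T\mathscr{T}_{LR}I_r$. The matrices $\mathscr{M}_l,\mathscr{M}_r$ are strictly lower triangular with $\mathscr{M}_l^{N-1}=\mathscr{M}_r^{N-1}=0$. Define $C_r:=(I-\mathscr{M}_r)^{-1}\mathscr{A}_r=\bigl(\sum_{i=0}^{N-2}\mathscr{M}_r^i\bigr)\mathscr{A}_r$ and $C_l:=(I-\mathscr{M}_l)^{-1}\mathscr{A}_l=\bigl(\sum_{i=0}^{N-2}\mathscr{M}_l^i\bigr)\mathscr{A}_l$. Error propagation operator. For a preconditioner $M^{-1}$ (with inverse $M$) of a linear operator $B$, the error propagation operator is $R:=M^{-1}(M-B)$; here $B=I-\mathscr{T}_{LR}$.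 *)

theory Defs
  imports "HOL-Analysis.Analysis" "HOL-Library.Function_Algebras" "HOL-Algebra.Ring"
begin

section \<open>Functions on subsets of the plane\<close>

text \<open>
  A function on a set \<open>S\<close> is represented by its extension by zero to the whole plane.
  Vector space operations are the pointwise ones, with complex scalars.
\<close>

type_synonym point = "real^2"
type_synonym cfun = "real^2 \<Rightarrow> complex"

definition cscale :: "complex \<Rightarrow> cfun \<Rightarrow> cfun" where
  "cscale c v = (\<lambda>x. c * v x)"

interpretation cfun: vector_space cscale
  by unfold_locales (auto simp: cscale_def fun_eq_iff algebra_simps)

definition functions_on :: "point set \<Rightarrow> cfun set" where
  "functions_on S = {v. \<forall>x. x \<notin> S \<longrightarrow> v x = 0}"

definition linear_from :: "cfun set \<Rightarrow> (cfun \<Rightarrow> cfun) \<Rightarrow> bool" where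
  "linear_from V T \<longleftrightarrow>
     (\<forall>u\<in>V. \<forall>v\<in>V. T (u + v) = T u + T v) \<and> (\<forall>c. \<forall>v\<in>V. T (cscale c v) = cscale c (T v))"

definition partial_deriv :: "2 \<Rightarrow> cfun \<Rightarrow> cfun" where
  "partial_deriv j v x = vector_derivative (\<lambda>t. v (x + t *\<^sub>R axis j 1)) (at 0)"

definition C1_on :: "point set \<Rightarrow> cfun \<Rightarrow> bool" where
  "C1_on U v \<longleftrightarrow> continuous_on U v \<and>
     (\<forall>j. (\<forall>x\<in>U. (\<lambda>t. v (x + t *\<^sub>R axis j 1)) differentiable (at 0)) \<and>
         continuous_on U (partial_deriv j v))"

definition C2_on :: "point set \<Rightarrow> cfun \<Rightarrow> bool" where
  "C2_on U v \<longleftrightarrow> C1_on U v \<and> (\<forall>j. C1_on U (partial_deriv j v))"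

definition laplacian :: "cfun \<Rightarrow> cfun" where
  "laplacian v x = (\<Sum>j\<in>UNIV. partial_deriv j (partial_deriv j v) x)"


section \<open>The strip decomposition and its local problems\<close>

datatype side = Lft | Rgt

text \<open>
  Strips are numbered from \<open>1\<close> to \<open>nstrips\<close>, from left to right; \<open>iface i s\<close> is the interface of
  strip \<open>i\<close> on side \<open>s\<close>. The space \<open>local_space i\<close> is the one in which the \<open>i\<close>-th local solution
  is sought, \<open>data_space i s\<close> is the space of interface functions on \<open>iface i s\<close>, \<open>iop i s\<close> is
  the interface operator there, and \<open>phys_bc i v = 0\<close> is the homogeneous condition on the part of
  the boundary of strip \<open>i\<close> contained in the boundary of the domain. The Helmholtz equation is
  understood pointwise inside the open strip, for twice continuously differentiable functions;
  boundary and interface conditions enter only through the given linear operators, so no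
  regularity up to the boundary is imposed.
\<close>

record strip_data =
  nstrips :: nat
  wavenumber :: complex
  omega :: "point set"
  strip :: "nat \<Rightarrow> point set"
  iface :: "nat \<Rightarrow> side \<Rightarrow> point set"
  local_space :: "nat \<Rightarrow> cfun set"
  source_space :: "nat \<Rightarrow> cfun set"
  data_space :: "nat \<Rightarrow> side \<Rightarrow> cfun set"
  iop :: "nat \<Rightarrow> side \<Rightarrow> cfun \<Rightarrow> cfun"
  phys_bc :: "nat \<Rightarrow> cfun \<Rightarrow> cfun"

definition has_interface :: "strip_data \<Rightarrow> nat \<Rightarrow> side \<Rightarrow> bool" where
  "has_interface D i s \<longleftrightarrow>
     (case s of Lft \<Rightarrow> 2 \<le> i \<and> i \<le> nstrips D | Rgt \<Rightarrow> 1 \<le> i \<and> i \<le> nstrips D - 1)"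

fun neighbour :: "nat \<Rightarrow> side \<Rightarrow> nat" where
  "neighbour i Lft = i - 1"
| "neighbour i Rgt = i + 1"

definition is_local_solution :: "strip_data \<Rightarrow> nat \<Rightarrow> cfun \<Rightarrow> cfun \<Rightarrow> cfun \<Rightarrow> cfun \<Rightarrow> bool" where
  "is_local_solution D i hl hr f v \<longleftrightarrow>
     v \<in> local_space D i \<and>
     (\<forall>x\<in>strip D i. - (wavenumber D)\<^sup>2 * v x - laplacian v x = f x) \<and>
     (2 \<le> i \<longrightarrow> iop D i Lft v = hl) \<and>
     (i \<le> nstrips D - 1 \<longrightarrow> iop D i Rgt v = hr) \<and>
     phys_bc D i v = 0"

definition local_sol :: "strip_data \<Rightarrow> nat \<Rightarrow> cfun \<Rightarrow> cfun \<Rightarrow> cfun \<Rightarrow> cfun" where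
  "local_sol D i hl hr f = (THE v. is_local_solution D i hl hr f v)"

text \<open>
  An interface operator is applied both to functions on its own strip and to functions on the
  neighbouring strip that contains the interface in its closure. The left interface of a strip is
  the one lying in the closure of the preceding strip, the right one that in the closure of
  the following strip.
\<close>

definition strip_geometry :: "strip_data \<Rightarrow> bool" where
  "strip_geometry D \<longleftrightarrow>
     2 \<le> nstrips D \<and>
     open (omega D) \<and> connected (omega D) \<and> bounded (omega D) \<and> omega D \<noteq> {} \<and>
     (\<forall>i\<in>{1..nstrips D}. open (strip D i) \<and> strip D i \<noteq> {} \<and> strip D i \<subseteq> omega D) \<and>
     omega D \<subseteq> (\<Union>i\<in>{1..nstrips D}. closure (strip D i)) \<and>
     (\<forall>i\<in>{1..nstrips D}.
        iface D i Lft \<union> iface D i Rgt = frontier (strip D i) - frontier (omega D) \<and>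
        iface D i Lft \<inter> iface D i Rgt = {}) \<and>
     iface D 1 Lft = {} \<and> iface D (nstrips D) Rgt = {} \<and>
     (\<forall>i s. has_interface D i s \<longrightarrow> iface D i s \<subseteq> closure (strip D (neighbour i s)))"

definition strip_spaces :: "strip_data \<Rightarrow> bool" where
  "strip_spaces D \<longleftrightarrow>
     (\<forall>i\<in>{1..nstrips D}.
        cfun.subspace (local_space D i) \<and> local_space D i \<subseteq> functions_on (strip D i) \<and>
        (\<forall>v\<in>local_space D i. C2_on (strip D i) v) \<and>
        cfun.subspace (source_space D i) \<and> source_space D i \<subseteq> functions_on (strip D i) \<and>
        linear_from (local_space D i) (phys_bc D i) \<and>
        phys_bc D i \<in> local_space D i
          \<rightarrow> functions_on (frontier (omega D) \<inter> frontier (strip D i))) \<and>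
     (\<forall>i s. has_interface D i s \<longrightarrow>
        cfun.subspace (data_space D i s) \<and> data_space D i s \<subseteq> functions_on (iface D i s) \<and>
        (\<forall>j\<in>{i, neighbour i s}.
           linear_from (local_space D j) (iop D i s) \<and>
           iop D i s \<in> local_space D j \<rightarrow> data_space D i s))"

definition locally_well_posed :: "strip_data \<Rightarrow> bool" where
  "locally_well_posed D \<longleftrightarrow>
     (\<forall>i\<in>{1..nstrips D}. \<forall>hl hr. \<forall>f\<in>source_space D i.
        (has_interface D i Lft \<longrightarrow> hl \<in> data_space D i Lft) \<and>
        (has_interface D i Rgt \<longrightarrow> hr \<in> data_space D i Rgt) \<longrightarrow>
        (\<exists>!v. is_local_solution D i hl hr f v))"

definition strip_problem :: "strip_data \<Rightarrow> bool" where
  "strip_problem D \<longleftrightarrow> strip_geometry D \<and> strip_spaces D \<and> locally_well_posed D"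


section \<open>Matrices of linear operators\<close>

text \<open>
  For \<open>n\<close> spaces \<open>H 1, \<dots>, H n\<close>, the entry \<open>(p, q)\<close> of an operator matrix is a linear map from
  \<open>H q\<close> to \<open>H p\<close>. Entries are extensional, and entries with an index outside \<open>{1..n}\<close> are
  \<open>undefined\<close>, so that equality of matrices is equality of all entries as operators.
\<close>

definition mk_opmat ::
    "nat \<Rightarrow> (nat \<Rightarrow> cfun set) \<Rightarrow> (nat \<Rightarrow> nat \<Rightarrow> cfun \<Rightarrow> cfun) \<Rightarrow> nat \<Rightarrow> nat \<Rightarrow> cfun \<Rightarrow> cfun" where
  "mk_opmat n H a =
     (\<lambda>p q. if p \<in> {1..n} \<and> q \<in> {1..n} then restrict (a p q) (H q) else undefined)"

definition opmat_ring :: "nat \<Rightarrow> (nat \<Rightarrow> cfun set) \<Rightarrow> (nat \<Rightarrow> nat \<Rightarrow> cfun \<Rightarrow> cfun) ring" where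
  "opmat_ring n H =
     \<lparr> carrier = {A. A = mk_opmat n H A \<and>
                    (\<forall>p\<in>{1..n}. \<forall>q\<in>{1..n}. A p q \<in> H q \<rightarrow> H p \<and> linear_from (H q) (A p q))},
       monoid.mult = (\<lambda>A B. mk_opmat n H (\<lambda>p q h. \<Sum>r\<in>{1..n}. A p r (B r q h))),
       one = mk_opmat n H (\<lambda>p q h. if p = q then h else 0),
       zero = mk_opmat n H (\<lambda>p q h. 0),
       add = (\<lambda>A B. mk_opmat n H (\<lambda>p q h. A p q h + B p q h)) \<rparr>"

text \<open>
  A scalar matrix acts by multiples of the identity. It is used only for diagonal \<open>c\<close>: a nonzero
  scalar in an off-diagonal position need not map \<open>H q\<close> to \<open>H p\<close>.
\<close>

definition scalar_opmat ::
    "nat \<Rightarrow> (nat \<Rightarrow> cfun set) \<Rightarrow> (nat \<Rightarrow> nat \<Rightarrow> complex) \<Rightarrow> nat \<Rightarrow> nat \<Rightarrow> cfun \<Rightarrow> cfun" where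
  "scalar_opmat n H c = mk_opmat n H (\<lambda>p q. cscale (c p q))"

definition transp :: "(nat \<Rightarrow> nat \<Rightarrow> complex) \<Rightarrow> nat \<Rightarrow> nat \<Rightarrow> complex" where
  "transp c = (\<lambda>p q. c q p)"


section \<open>The substructured operator in left-right numbering\<close>

text \<open>
  Position \<open>p\<close> of the ordering \<open>(2, Lft), \<dots>, (N, Lft), (N - 1, Rgt), \<dots>, (1, Rgt)\<close>.
\<close>

definition lr_label :: "nat \<Rightarrow> nat \<Rightarrow> nat \<times> side" where
  "lr_label N p = (if p \<le> N - 1 then (p + 1, Lft) else (2 * N - 1 - p, Rgt))"

definition lr_size :: "strip_data \<Rightarrow> nat" where
  "lr_size D = 2 * nstrips D - 2"

definition lr_space :: "strip_data \<Rightarrow> nat \<Rightarrow> cfun set" where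
  "lr_space D p = (case lr_label (nstrips D) p of (i, s) \<Rightarrow> data_space D i s)"

definition LR :: "strip_data \<Rightarrow> (nat \<Rightarrow> nat \<Rightarrow> cfun \<Rightarrow> cfun) ring" where
  "LR D = opmat_ring (lr_size D) (lr_space D)"

fun T_entry :: "strip_data \<Rightarrow> nat \<times> side \<Rightarrow> nat \<times> side \<Rightarrow> cfun \<Rightarrow> cfun" where
  "T_entry D (j, Lft) (i, Lft) h =
     (if j = i + 1 \<and> 2 \<le> i \<and> i \<le> nstrips D - 1
      then iop D (i + 1) Lft (local_sol D i h 0 0) else 0)"
| "T_entry D (j, Lft) (i, Rgt) h =
     (if j = i + 1 \<and> 1 \<le> i \<and> i \<le> nstrips D - 1
      then iop D (i + 1) Lft (local_sol D i 0 h 0) else 0)"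
| "T_entry D (j, Rgt) (i, Rgt) h =
     (if j + 1 = i \<and> 2 \<le> i \<and> i \<le> nstrips D - 1
      then iop D (i - 1) Rgt (local_sol D i 0 h 0) else 0)"
| "T_entry D (j, Rgt) (i, Lft) h =
     (if j + 1 = i \<and> 2 \<le> i \<and> i \<le> nstrips D
      then iop D (i - 1) Rgt (local_sol D i h 0 0) else 0)"

definition T_LR :: "strip_data \<Rightarrow> nat \<Rightarrow> nat \<Rightarrow> cfun \<Rightarrow> cfun" where
  "T_LR D = mk_opmat (lr_size D) (lr_space D)
     (\<lambda>p q. T_entry D (lr_label (nstrips D) p) (lr_label (nstrips D) q))"

definition I_l :: "strip_data \<Rightarrow> nat \<Rightarrow> nat \<Rightarrow> complex" where
  "I_l D p q = (if p = q \<and> p \<in> {1..nstrips D - 1} then 1 else 0)"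

definition I_r :: "strip_data \<Rightarrow> nat \<Rightarrow> nat \<Rightarrow> complex" where
  "I_r D p q = (if p = q \<and> p \<in> {nstrips D..2 * nstrips D - 2} then 1 else 0)"

definition LR_scalar ::
    "strip_data \<Rightarrow> (nat \<Rightarrow> nat \<Rightarrow> complex) \<Rightarrow> nat \<Rightarrow> nat \<Rightarrow> cfun \<Rightarrow> cfun" where
  "LR_scalar D = scalar_opmat (lr_size D) (lr_space D)"

definition M_l :: "strip_data \<Rightarrow> nat \<Rightarrow> nat \<Rightarrow> cfun \<Rightarrow> cfun" where
  "M_l D = LR_scalar D (transp (I_l D)) \<otimes>\<^bsub>LR D\<^esub> T_LR D \<otimes>\<^bsub>LR D\<^esub> LR_scalar D (I_l D)"

definition A_l :: "strip_data \<Rightarrow> nat \<Rightarrow> nat \<Rightarrow> cfun \<Rightarrow> cfun" where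
  "A_l D = LR_scalar D (transp (I_l D)) \<otimes>\<^bsub>LR D\<^esub> T_LR D \<otimes>\<^bsub>LR D\<^esub> LR_scalar D (I_r D)"

definition A_r :: "strip_data \<Rightarrow> nat \<Rightarrow> nat \<Rightarrow> cfun \<Rightarrow> cfun" where
  "A_r D = LR_scalar D (transp (I_r D)) \<otimes>\<^bsub>LR D\<^esub> T_LR D \<otimes>\<^bsub>LR D\<^esub> LR_scalar D (I_l D)"

definition M_r :: "strip_data \<Rightarrow> nat \<Rightarrow> nat \<Rightarrow> cfun \<Rightarrow> cfun" where
  "M_r D = LR_scalar D (transp (I_r D)) \<otimes>\<^bsub>LR D\<^esub> T_LR D \<otimes>\<^bsub>LR D\<^esub> LR_scalar D (I_r D)"

definition C_r :: "strip_data \<Rightarrow> nat \<Rightarrow> nat \<Rightarrow> cfun \<Rightarrow> cfun" where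
  "C_r D = inv\<^bsub>LR D\<^esub> (\<one>\<^bsub>LR D\<^esub> \<ominus>\<^bsub>LR D\<^esub> M_r D) \<otimes>\<^bsub>LR D\<^esub> A_r D"

definition C_l :: "strip_data \<Rightarrow> nat \<Rightarrow> nat \<Rightarrow> cfun \<Rightarrow> cfun" where
  "C_l D = inv\<^bsub>LR D\<^esub> (\<one>\<^bsub>LR D\<^esub> \<ominus>\<^bsub>LR D\<^esub> M_l D) \<otimes>\<^bsub>LR D\<^esub> A_l D"

text \<open>The first matrix argument is the preconditioner in inverted form, \<open>M\<close> being its inverse.\<close>

definition error_propagation :: "('a, 'b) ring_scheme \<Rightarrow> 'a \<Rightarrow> 'a \<Rightarrow> 'a" where
  "error_propagation G M_inv B = M_inv \<otimes>\<^bsub>G\<^esub> (inv\<^bsub>G\<^esub> M_inv \<ominus>\<^bsub>G\<^esub> B)"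

definition M_inv_SGS :: "strip_data \<Rightarrow> nat \<Rightarrow> nat \<Rightarrow> cfun \<Rightarrow> cfun" where
  "M_inv_SGS D =
     inv\<^bsub>LR D\<^esub> (\<one>\<^bsub>LR D\<^esub> \<ominus>\<^bsub>LR D\<^esub> M_r D \<ominus>\<^bsub>LR D\<^esub> A_r D) \<otimes>\<^bsub>LR D\<^esub>
     inv\<^bsub>LR D\<^esub> (\<one>\<^bsub>LR D\<^esub> \<ominus>\<^bsub>LR D\<^esub> M_l D \<ominus>\<^bsub>LR D\<^esub> A_l D)"

definition R_SGS :: "strip_data \<Rightarrow> nat \<Rightarrow> nat \<Rightarrow> cfun \<Rightarrow> cfun" where
  "R_SGS D = error_propagation (LR D) (M_inv_SGS D) (\<one>\<^bsub>LR D\<^esub> \<ominus>\<^bsub>LR D\<^esub> T_LR D)"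

end

theory Submission
  imports Defs
begin

text \<open>
  Write \<open>L = M_l + A_l\<close> and \<open>K = M_r + A_r\<close> for the upper and the lower block row of \<open>T_LR\<close>. The
  preconditioner is the inverse of \<open>(1 - L)(1 - K)\<close>, and \<open>(1 - L)(1 - K) = (1 - T_LR) + L K\<close>: the splitting
  misses only the product \<open>L K\<close>. Hence \<open>R_SGS = inv (1 - K) * inv (1 - L) * L * K\<close>, and the closed form
  arises by moving the two inverses through the factors.

  The block pattern makes this possible. With the diagonal projections \<open>p + q = 1\<close>,
  \<open>p q = q p = 0\<close>, the four blocks are \<open>p T p\<close>, \<open>p T q\<close>, \<open>q T q\<close>, \<open>q T p\<close>, so a product of two
  blocks vanishes whenever the inner projections disagree. This gives
  \<open>1 - L = (1 - M_l)(1 - C_l)\<close> with \<open>C_l\<^sup>2 = 0\<close>, hence \<open>(1 - L) C_l = A_l\<close>; moreover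
  \<open>M_l K = 0\<close>. Therefore \<open>(1 - L) C_l K = A_l K = L K\<close>. Likewise \<open>(1 - K)(1 + C_r) = 1 - M_r\<close>, and
  \<open>M_r C_l = 0\<close>, so \<open>(1 - K)(1 + C_r) C_l K = C_l K\<close>. Together these say
  \<open>R_SGS = (1 + C_r) C_l K\<close>. In a power of this product the inner factors collapse, because
  \<open>K (1 + C_r) C_l = (M_r C_r + A_r) C_l = C_r C_l\<close>, where \<open>C_r = M_r C_r + A_r\<close> is the equation that
  defines \<open>C_r\<close>. This purely algebraic part is \<open>symmetric_gauss_seidel_error\<close>.

  It remains to see that the argument takes place in a ring and that the inverses exist. Operator
  matrices over a family of subspaces form a ring (locale \<open>operator_matrices\<close>). That \<open>T_LR\<close>
  belongs to it rests on the well-posedness of the local problems, since uniqueness of their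
  solutions makes the solution operators linear (\<open>local_sol_linear\<close>). Finally, information on one
  side travels from strip to strip in a single direction, and the left-right numbering follows that
  direction; so \<open>M_l\<close> and \<open>M_r\<close> are strictly lower triangular, hence nilpotent, and \<open>1 - M_l\<close>,
  \<open>1 - M_r\<close> are units.
\<close>

section \<open>The Gauss-Seidel error in an abstract ring\<close>

context ring
begin

text \<open>The inverse is the Neumann series, truncated by nilpotency.\<close>

lemma one_minus_nilpotent_Unit:
  fixes k :: nat
  assumes M: "M \<in> carrier R" and nil: "M [^] k = \<zero>"
  shows "\<one> \<ominus> M \<in> Units R"
proof -
  have "\<exists>S\<in>carrier R. (\<one> \<ominus> M) \<otimes> S = \<one> \<ominus> M [^] k \<and> S \<otimes> (\<one> \<ominus> M) = \<one> \<ominus> M [^] k" for k :: nat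
  proof (induction k)
    case 0
    show ?case using M by (intro bexI[of _ \<zero>]) (simp_all add: minus_eq r_neg)
  next
    case (Suc k)
    then obtain S where S: "S \<in> carrier R" "(\<one> \<ominus> M) \<otimes> S = \<one> \<ominus> M [^] k"
      "S \<otimes> (\<one> \<ominus> M) = \<one> \<ominus> M [^] k" by blast
    have c: "M [^] k \<in> carrier R" using M by simp
    have comm: "M \<otimes> M [^] k = M [^] k \<otimes> M"
      using M by (metis nat_pow_Suc nat_pow_Suc2)
    have collapse: "(\<one> \<ominus> x) \<oplus> (x \<ominus> y) = \<one> \<ominus> y" if "x \<in> carrier R" "y \<in> carrier R" for x y
      using that by (simp add: minus_eq a_assoc r_neg1 r_neg2)
    have "(\<one> \<ominus> M) \<otimes> (S \<oplus> M [^] k) = (\<one> \<ominus> M [^] k) \<oplus> (M [^] k \<ominus> M [^] k \<otimes> M)"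
      using S M c by (simp add: r_distr) (simp add: minus_eq l_distr l_minus comm)
    moreover have "(S \<oplus> M [^] k) \<otimes> (\<one> \<ominus> M) = (\<one> \<ominus> M [^] k) \<oplus> (M [^] k \<ominus> M [^] k \<otimes> M)"
      using S M c by (simp add: l_distr) (simp add: minus_eq r_distr r_minus)
    ultimately show ?case
      using S M c collapse[of "M [^] k" "M [^] k \<otimes> M"]
      by (intro bexI[of _ "S \<oplus> M [^] k"]) simp_all
  qed
  from this[of k] obtain S where "S \<in> carrier R" "(\<one> \<ominus> M) \<otimes> S = \<one>" "S \<otimes> (\<one> \<ominus> M) = \<one>"
    using nil by (auto simp: minus_eq)
  then show ?thesis using M unfolding Units_def by auto
qed

lemma inv_mult_Units:
  assumes "x \<in> Units R" "y \<in> Units R"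
  shows "inv (x \<otimes> y) = inv y \<otimes> inv x"
proof -
  have "(x \<otimes> y) \<otimes> (inv y \<otimes> inv x) = x \<otimes> (y \<otimes> inv y) \<otimes> inv x"
    "(inv y \<otimes> inv x) \<otimes> (x \<otimes> y) = inv y \<otimes> (inv x \<otimes> x) \<otimes> y"
    using assms by (simp_all only: m_assoc Units_closed Units_inv_closed m_closed)
  then show ?thesis using assms by (intro inv_char) (simp_all add: Units_closed)
qed

lemma Unit_mult_eqD:
  assumes "U \<in> Units R" "x \<in> carrier R" "y \<in> carrier R" "U \<otimes> x = y"
  shows "inv U \<otimes> y = x"
  using assms by (metis Units_closed Units_inv_closed Units_l_inv l_one m_assoc)

lemma mult_inv_one_minus_absorb:
  assumes "\<one> \<ominus> M \<in> Units R" "M \<in> carrier R" "A \<in> carrier R" "A \<otimes> M = \<zero>"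
  shows "A \<otimes> inv (\<one> \<ominus> M) = A"
proof -
  have "A \<otimes> (\<one> \<ominus> M) = A"
    using assms by (simp add: minus_eq r_distr r_minus)
  then show ?thesis
    using assms by (metis Units_closed Units_inv_closed Units_r_inv m_assoc r_one)
qed

text \<open>
  One sweep over the block row \<open>M + A\<close>, where \<open>M\<close> is the diagonal and \<open>A\<close> the off-diagonal block.
  The range of either block misses the part on which \<open>A\<close> acts, whence the two vanishing products.
\<close>

context
  fixes M A C
  assumes M: "M \<in> carrier R" and A: "A \<in> carrier R"
    and AM: "A \<otimes> M = \<zero>" and AA: "A \<otimes> A = \<zero>"
    and unit: "\<one> \<ominus> M \<in> Units R"
    and C_def: "C = inv (\<one> \<ominus> M) \<otimes> A"
begin

lemma transfer_closed: "C \<in> carrier R"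
  using A unit by (simp add: C_def)

lemma one_minus_mult_transfer: "(\<one> \<ominus> M) \<otimes> C = A"
  unfolding C_def using A unit
  by (metis Units_closed Units_inv_closed Units_r_inv l_one m_assoc)

lemma transfer_fixed_point: "M \<otimes> C \<oplus> A = C"
proof -
  have "A = C \<oplus> \<ominus> (M \<otimes> C)"
    using one_minus_mult_transfer M transfer_closed by (simp add: minus_eq l_distr l_minus)
  then show ?thesis using M transfer_closed by (metis a_comm a_inv_closed m_closed r_neg2)
qed

lemma mult_transfer_zero: "A \<otimes> C = \<zero>"
proof -
  have "A \<otimes> C = A \<otimes> inv (\<one> \<ominus> M) \<otimes> A"
    unfolding C_def using A unit by (simp add: m_assoc)
  then show ?thesis
    using mult_inv_one_minus_absorb[OF unit M A AM] AA by simp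
qed

lemma transfer_square_zero: "C \<otimes> C = \<zero>"
  using mult_transfer_zero A unit transfer_closed
  by (subst (1) C_def) (simp add: m_assoc)

lemma one_minus_transfer_inverse:
  "(\<one> \<ominus> C) \<otimes> (\<one> \<oplus> C) = \<one>" "(\<one> \<oplus> C) \<otimes> (\<one> \<ominus> C) = \<one>"
  using transfer_closed transfer_square_zero
  by (simp_all add: minus_eq l_distr r_distr l_minus r_minus a_assoc r_neg l_neg)

lemma block_factorization: "\<one> \<ominus> M \<ominus> A = (\<one> \<ominus> M) \<otimes> (\<one> \<ominus> C)"
  using one_minus_mult_transfer M A transfer_closed
  by (simp add: minus_eq r_distr r_minus)

lemma block_Unit: "\<one> \<ominus> M \<ominus> A \<in> Units R"
proof -
  have "\<one> \<ominus> C \<in> Units R"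
    using one_minus_transfer_inverse transfer_closed unfolding Units_def
    by (auto intro!: bexI[of _ "\<one> \<oplus> C"])
  then show ?thesis using unit by (simp add: block_factorization)
qed

lemma block_mult_one_plus_transfer: "(\<one> \<ominus> M \<ominus> A) \<otimes> (\<one> \<oplus> C) = \<one> \<ominus> M"
  unfolding block_factorization using one_minus_transfer_inverse(1) transfer_closed M
  by (simp add: m_assoc)

lemma block_mult_transfer: "(\<one> \<ominus> M \<ominus> A) \<otimes> C = A"
proof -
  have "(\<one> \<ominus> C) \<otimes> C = C"
    using transfer_closed transfer_square_zero by (simp add: minus_eq l_distr l_minus)
  then show ?thesis
    unfolding block_factorization using transfer_closed M one_minus_mult_transfer
    by (simp add: m_assoc)
qed

end

text \<open>
  The hypotheses are the multiplication table of a \<open>2 \<times> 2\<close> block decomposition: a product vanishes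
  if the column block of the left factor is not the row block of the right one.
\<close>

theorem symmetric_gauss_seidel_error:
  fixes n :: nat
  assumes car: "Ml \<in> carrier R" "Al \<in> carrier R" "Mr \<in> carrier R" "Ar \<in> carrier R"
    and l: "Al \<otimes> Ml = \<zero>" "Al \<otimes> Al = \<zero>" "\<one> \<ominus> Ml \<in> Units R"
    and r: "Ar \<otimes> Mr = \<zero>" "Ar \<otimes> Ar = \<zero>" "\<one> \<ominus> Mr \<in> Units R"
    and lr: "Ml \<otimes> Mr = \<zero>" "Ml \<otimes> Ar = \<zero>"
    and rl: "Mr \<otimes> Ml = \<zero>" "Mr \<otimes> Al = \<zero>"
    and Cl: "Cl = inv (\<one> \<ominus> Ml) \<otimes> Al" and Cr: "Cr = inv (\<one> \<ominus> Mr) \<otimes> Ar"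
    and T: "T = (Ml \<oplus> Al) \<oplus> (Mr \<oplus> Ar)"
    and E: "E = error_propagation R (inv (\<one> \<ominus> Mr \<ominus> Ar) \<otimes> inv (\<one> \<ominus> Ml \<ominus> Al)) (\<one> \<ominus> T)"
  shows "E = (\<one> \<oplus> Cr) \<otimes> Cl \<otimes> (Mr \<oplus> Ar)"
    and "n \<ge> 1 \<Longrightarrow> E [^] n = (\<one> \<oplus> Cr) \<otimes> Cl \<otimes> ((Cr \<otimes> Cl) [^] (n - 1)) \<otimes> (Mr \<oplus> Ar)"
proof -
  note lemL = car(1,2) l(1,2,3) Cl and lemR = car(3,4) r(1,2,3) Cr
  have c: "Cl \<in> carrier R" "Cr \<in> carrier R"
    using transfer_closed[OF lemL] transfer_closed[OF lemR] by simp_all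
  define U where "U = \<one> \<ominus> Mr \<ominus> Ar"
  define V where "V = \<one> \<ominus> Ml \<ominus> Al"
  define L where "L = Ml \<oplus> Al"
  define K where "K = Mr \<oplus> Ar"
  have LK: "L \<in> carrier R" "K \<in> carrier R" using car by (simp_all add: L_def K_def)
  have UV: "U \<in> Units R" "V \<in> Units R"
    using block_Unit[OF lemL] block_Unit[OF lemR] by (simp_all add: U_def V_def)
  note UVc = UV[THEN Units_closed]
  have U_eq: "U = \<one> \<ominus> K" and V_eq: "V = \<one> \<ominus> L"
    using car by (simp_all add: U_def V_def K_def L_def minus_eq minus_add a_assoc)
  \<comment> \<open>The equation \<open>Cl = Ml Cl + Al\<close> shows that the range of \<open>Cl\<close> lies in the left block.\<close>
  have MrCl: "Mr \<otimes> Cl = \<zero>"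
  proof -
    have "Mr \<otimes> Cl = Mr \<otimes> (Ml \<otimes> Cl \<oplus> Al)"
      using transfer_fixed_point[OF lemL] by simp
    also have "\<dots> = Mr \<otimes> Ml \<otimes> Cl \<oplus> Mr \<otimes> Al"
      using car c by (simp add: r_distr m_assoc)
    finally show ?thesis using rl c by simp
  qed

  have "inv (inv U \<otimes> inv V) = V \<otimes> U"
    using UV by (simp add: inv_mult_Units)
  moreover have "V \<otimes> U \<ominus> (\<one> \<ominus> T) = L \<otimes> K"
  proof -
    have VU: "V \<otimes> U = L \<otimes> K \<oplus> (\<one> \<ominus> (L \<oplus> K))"
      unfolding U_eq V_eq using LK
      by (simp add: minus_eq l_distr r_distr l_minus r_minus minus_add minus_minus a_ac)
    show ?thesis
      unfolding VU T L_def[symmetric] K_def[symmetric]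
      using LK by (simp add: minus_eq a_assoc r_neg)
  qed
  ultimately have E1: "E = inv U \<otimes> inv V \<otimes> (L \<otimes> K)"
    unfolding E error_propagation_def U_def[symmetric] V_def[symmetric] by simp
  have MlK: "Ml \<otimes> K = \<zero>" using lr car by (simp add: K_def r_distr)
  have "V \<otimes> (Cl \<otimes> K) = L \<otimes> K"
  proof -
    have "V \<otimes> (Cl \<otimes> K) = Al \<otimes> K"
      using block_mult_transfer[OF lemL] UVc c LK by (simp add: V_def m_assoc[symmetric])
    then show ?thesis using MlK car LK by (simp add: L_def l_distr)
  qed
  then have E2: "E = inv U \<otimes> (Cl \<otimes> K)"
    unfolding E1 using Unit_mult_eqD[OF UV(2)] UV LK c by (simp add: m_assoc)
  have "U \<otimes> ((\<one> \<oplus> Cr) \<otimes> Cl \<otimes> K) = Cl \<otimes> K"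
  proof -
    have "U \<otimes> ((\<one> \<oplus> Cr) \<otimes> Cl \<otimes> K) = (U \<otimes> (\<one> \<oplus> Cr)) \<otimes> Cl \<otimes> K"
      using UVc c LK by (simp add: m_assoc)
    also have "\<dots> = (\<one> \<ominus> Mr) \<otimes> Cl \<otimes> K"
      using block_mult_one_plus_transfer[OF lemR] by (simp add: U_def)
    also have "(\<one> \<ominus> Mr) \<otimes> Cl = Cl"
      using MrCl car c by (simp add: minus_eq l_distr l_minus)
    finally show ?thesis .
  qed
  then have E3: "E = (\<one> \<oplus> Cr) \<otimes> Cl \<otimes> K"
    unfolding E2 using Unit_mult_eqD[OF UV(1)] LK c by simp
  then show "E = (\<one> \<oplus> Cr) \<otimes> Cl \<otimes> (Mr \<oplus> Ar)" by (simp add: K_def)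

  define F where "F = (\<one> \<oplus> Cr) \<otimes> Cl"
  have Fc: "F \<in> carrier R" using c by (simp add: F_def)
  have KF: "K \<otimes> F = Cr \<otimes> Cl"
  proof -
    have ArCr: "Ar \<otimes> Cr = \<zero>" by (rule mult_transfer_zero[OF lemR])
    have "K \<otimes> F = Mr \<otimes> Cl \<oplus> (Mr \<otimes> Cr \<oplus> Ar \<oplus> Ar \<otimes> Cr) \<otimes> Cl"
      using car c by (simp add: K_def F_def l_distr r_distr m_assoc a_ac)
    also have "\<dots> = Cr \<otimes> Cl"
      using car c by (simp add: MrCl ArCr transfer_fixed_point[OF lemR])
    finally show ?thesis .
  qed
  \<comment> \<open>Since \<open>E = F K\<close>, each further factor \<open>E\<close> contributes one product \<open>K F = Cr Cl\<close> in the middle.\<close>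
  have "E [^] Suc m = F \<otimes> (Cr \<otimes> Cl) [^] m \<otimes> K" for m
  proof (induction m)
    case 0
    then show ?case using E3 Fc LK by (simp add: F_def)
  next
    case (Suc m)
    have "E [^] Suc (Suc m) = F \<otimes> (Cr \<otimes> Cl) [^] m \<otimes> K \<otimes> (F \<otimes> K)"
      using Suc E3 by (simp add: F_def)
    also have "\<dots> = F \<otimes> ((Cr \<otimes> Cl) [^] m \<otimes> (K \<otimes> F)) \<otimes> K"
      using Fc LK c by (simp add: m_assoc)
    finally show ?case by (simp add: KF)
  qed
  from this[of "n - 1"]
  show "n \<ge> 1 \<Longrightarrow> E [^] n = (\<one> \<oplus> Cr) \<otimes> Cl \<otimes> ((Cr \<otimes> Cl) [^] (n - 1)) \<otimes> (Mr \<oplus> Ar)"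
    by (simp add: F_def K_def)
qed

end

section \<open>The ring of operator matrices\<close>

text \<open>
  Matrix entries are compared as elements of a space of functions. Simplification must not evaluate
  the pointwise operations under an eta-expanded \<open>\<lambda>\<close>, which would take sums of functions apart.
\<close>

declare plus_fun_apply [simp del] zero_fun_apply [simp del] uminus_apply [simp del]

lemma linear_from_zero:
  assumes "cfun.subspace V" "linear_from V T"
  shows "T 0 = 0"
proof -
  have "(0::cfun) \<in> V" using assms(1) by (rule cfun.subspace_0)
  then have "T (0 + 0) = T 0 + T 0" using assms(2) unfolding linear_from_def by blast
  then show ?thesis by simp
qed

lemma linear_from_sum:
  assumes V: "cfun.subspace V" "linear_from V T" and f: "\<And>r. r \<in> S \<Longrightarrow> f r \<in> V"
  shows "T (sum f S) = (\<Sum>r\<in>S. T (f r))"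
proof (cases "finite S")
  case True
  then show ?thesis using f
  proof (induction S rule: finite_induct)
    case empty
    then show ?case using linear_from_zero[OF V] by simp
  next
    case (insert x S)
    then have "sum f S \<in> V" by (intro cfun.subspace_sum[OF V(1)]) auto
    then have "T (f x + sum f S) = T (f x) + T (sum f S)"
      using V(2) insert.prems unfolding linear_from_def by blast
    then show ?case using insert by simp
  qed
qed (use linear_from_zero[OF V] in simp)

lemma mk_opmat_apply [simp]:
  "p \<in> {1..n} \<Longrightarrow> q \<in> {1..n} \<Longrightarrow> h \<in> H q \<Longrightarrow> mk_opmat n H a p q h = a p q h"
  by (simp add: mk_opmat_def)

lemma mk_opmat_cong:
  assumes "\<And>p q h. \<lbrakk>p \<in> {1..n}; q \<in> {1..n}; h \<in> H q\<rbrakk> \<Longrightarrow> a p q h = b p q h"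
  shows "mk_opmat n H a = mk_opmat n H b"
  using assms unfolding mk_opmat_def by (intro ext) (auto simp: restrict_def)

locale operator_matrices =
  fixes n :: nat and H :: "nat \<Rightarrow> cfun set"
  assumes sub: "\<And>p. p \<in> {1..n} \<Longrightarrow> cfun.subspace (H p)"
begin

abbreviation "G \<equiv> opmat_ring n H"

lemma carrier_iff:
  "A \<in> carrier G \<longleftrightarrow> A = mk_opmat n H A \<and>
    (\<forall>p\<in>{1..n}. \<forall>q\<in>{1..n}. A p q \<in> H q \<rightarrow> H p \<and> linear_from (H q) (A p q))"
  unfolding opmat_ring_def by simp

lemma opmat_eqI:
  assumes "A \<in> carrier G" "B \<in> carrier G"
    "\<And>p q h. \<lbrakk>p \<in> {1..n}; q \<in> {1..n}; h \<in> H q\<rbrakk> \<Longrightarrow> A p q h = B p q h"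
  shows "A = B"
proof -
  have "A = mk_opmat n H A" "B = mk_opmat n H B"
    using assms(1,2) unfolding carrier_iff by blast+
  then show ?thesis using mk_opmat_cong[of n H A B] assms(3) by metis
qed

lemma mk_opmat_closedI:
  assumes "\<And>p q h. \<lbrakk>p \<in> {1..n}; q \<in> {1..n}; h \<in> H q\<rbrakk> \<Longrightarrow> a p q h \<in> H p"
    and "\<And>p q. \<lbrakk>p \<in> {1..n}; q \<in> {1..n}\<rbrakk> \<Longrightarrow> linear_from (H q) (a p q)"
  shows "mk_opmat n H a \<in> carrier G"
proof -
  have "linear_from (H q) (mk_opmat n H a p q)" if pq: "p \<in> {1..n}" "q \<in> {1..n}" for p q
    using assms(2)[OF pq] pq sub[OF pq(2)] unfolding linear_from_def
    by (simp add: cfun.subspace_add cfun.subspace_scale)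
  moreover have "mk_opmat n H a = mk_opmat n H (mk_opmat n H a)"
    by (intro mk_opmat_cong) simp
  ultimately show ?thesis using assms(1) by (auto simp: opmat_ring_def)
qed

lemma entry_closed:
  "\<lbrakk>A \<in> carrier G; p \<in> {1..n}; q \<in> {1..n}; h \<in> H q\<rbrakk> \<Longrightarrow> A p q h \<in> H p"
  unfolding carrier_iff by (blast dest: funcset_mem)

lemma entry_linear:
  "\<lbrakk>A \<in> carrier G; p \<in> {1..n}; q \<in> {1..n}\<rbrakk> \<Longrightarrow> linear_from (H q) (A p q)"
  unfolding carrier_iff by blast

lemma entry_add:
  "\<lbrakk>A \<in> carrier G; p \<in> {1..n}; q \<in> {1..n}; u \<in> H q; v \<in> H q\<rbrakk> \<Longrightarrow> A p q (u + v) = A p q u + A p q v"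
  using entry_linear unfolding linear_from_def by blast

lemma entry_scale:
  "\<lbrakk>A \<in> carrier G; p \<in> {1..n}; q \<in> {1..n}; u \<in> H q\<rbrakk> \<Longrightarrow> A p q (cscale c u) = cscale c (A p q u)"
  using entry_linear unfolding linear_from_def by blast

lemma entry_zero: "\<lbrakk>A \<in> carrier G; p \<in> {1..n}; q \<in> {1..n}\<rbrakk> \<Longrightarrow> A p q 0 = 0"
  using entry_linear sub linear_from_zero by blast

lemma opmat_apply:
  assumes "p \<in> {1..n}" "q \<in> {1..n}" "h \<in> H q"
  shows "(A \<otimes>\<^bsub>G\<^esub> B) p q h = (\<Sum>r\<in>{1..n}. A p r (B r q h))"
    and "(A \<oplus>\<^bsub>G\<^esub> B) p q h = A p q h + B p q h"
    and "\<one>\<^bsub>G\<^esub> p q h = (if p = q then h else 0)"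
    and "\<zero>\<^bsub>G\<^esub> p q h = 0"
  using assms by (simp_all add: opmat_ring_def)

lemma mult_closed:
  assumes A: "A \<in> carrier G" and B: "B \<in> carrier G"
  shows "A \<otimes>\<^bsub>G\<^esub> B \<in> carrier G"
proof -
  have "mk_opmat n H (\<lambda>p q h. \<Sum>r\<in>{1..n}. A p r (B r q h)) \<in> carrier G"
  proof (rule mk_opmat_closedI)
    fix p q h assume "p \<in> {1..n}" "q \<in> {1..n}" "h \<in> H q"
    then show "(\<Sum>r\<in>{1..n}. A p r (B r q h)) \<in> H p"
      using entry_closed[OF A] entry_closed[OF B] by (intro cfun.subspace_sum sub) auto
  next
    fix p q assume pq: "p \<in> {1..n}" "q \<in> {1..n}"
    have "A p r (B r q (u + v)) = A p r (B r q u) + A p r (B r q v)"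
      "A p r (B r q (cscale c u)) = cscale c (A p r (B r q u))"
      if "r \<in> {1..n}" "u \<in> H q" "v \<in> H q" for r u v c
      using that pq by (simp_all only: entry_add[OF A] entry_add[OF B] entry_scale[OF A]
          entry_scale[OF B] entry_closed[OF B])
    then show "linear_from (H q) (\<lambda>h. \<Sum>r\<in>{1..n}. A p r (B r q h))"
      unfolding linear_from_def
      by (auto simp: sum.distrib[symmetric] cfun.scale_sum_right intro!: sum.cong)
  qed
  then show ?thesis by (simp add: opmat_ring_def)
qed

lemma add_closed:
  assumes A: "A \<in> carrier G" and B: "B \<in> carrier G"
  shows "A \<oplus>\<^bsub>G\<^esub> B \<in> carrier G"
proof -
  have "mk_opmat n H (\<lambda>p q h. A p q h + B p q h) \<in> carrier G"
    by (rule mk_opmat_closedI)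
       (auto simp: linear_from_def entry_add[OF A] entry_add[OF B] entry_scale[OF A]
          entry_scale[OF B] cfun.scale_right_distrib
          intro!: cfun.subspace_add[OF sub] entry_closed[OF A] entry_closed[OF B])
  then show ?thesis by (simp add: opmat_ring_def)
qed

text \<open>
  Diagonality is essential: off the diagonal only the scalar zero is sure to map \<open>H q\<close> to \<open>H p\<close>.
\<close>

lemma scalar_opmat_closed:
  assumes "\<And>p q. p \<noteq> q \<Longrightarrow> c p q = 0"
  shows "scalar_opmat n H c \<in> carrier G"
  unfolding scalar_opmat_def
proof (rule mk_opmat_closedI)
  fix p q h assume "p \<in> {1..n}" "q \<in> {1..n}" "h \<in> H q"
  then show "cscale (c p q) h \<in> H p"
    using assms[of p q] sub[of p]
    by (cases "p = q") (auto simp: cfun.subspace_scale cfun.subspace_0)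
qed (auto simp: linear_from_def cfun.scale_right_distrib cfun.scale_left_commute)

lemma one_zero_closed: "\<one>\<^bsub>G\<^esub> \<in> carrier G" "\<zero>\<^bsub>G\<^esub> \<in> carrier G"
proof -
  have "\<one>\<^bsub>G\<^esub> = scalar_opmat n H (\<lambda>p q. if p = q then 1 else 0)"
    and "\<zero>\<^bsub>G\<^esub> = scalar_opmat n H (\<lambda>p q. 0)"
    unfolding scalar_opmat_def opmat_ring_def by (auto intro!: mk_opmat_cong)
  then show "\<one>\<^bsub>G\<^esub> \<in> carrier G" "\<zero>\<^bsub>G\<^esub> \<in> carrier G"
    using scalar_opmat_closed by simp_all
qed

lemma neg_exists:
  assumes A: "A \<in> carrier G"
  shows "\<exists>B\<in>carrier G. B \<oplus>\<^bsub>G\<^esub> A = \<zero>\<^bsub>G\<^esub>"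
proof (rule bexI)
  let ?B = "mk_opmat n H (\<lambda>p q h. cscale (- 1) (A p q h))"
  show B: "?B \<in> carrier G"
    by (rule mk_opmat_closedI)
       (auto simp: linear_from_def entry_add[OF A] entry_scale[OF A] cfun.scale_right_distrib
          cfun.scale_left_commute simp del: cfun.scale_minus_left
          intro!: cfun.subspace_scale[OF sub] entry_closed[OF A])
  show "?B \<oplus>\<^bsub>G\<^esub> A = \<zero>\<^bsub>G\<^esub>"
    by (intro opmat_eqI add_closed A B one_zero_closed) (simp add: opmat_apply)
qed

sublocale ring G
proof (intro ringI abelian_groupI monoidI)
  fix A B C assume ABC: "A \<in> carrier G" "B \<in> carrier G" "C \<in> carrier G"
  note cl = ABC add_closed mult_closed
  show "A \<oplus>\<^bsub>G\<^esub> B \<oplus>\<^bsub>G\<^esub> C = A \<oplus>\<^bsub>G\<^esub> (B \<oplus>\<^bsub>G\<^esub> C)"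
    by (rule opmat_eqI) (simp_all add: opmat_apply cl add.assoc)
  show "A \<oplus>\<^bsub>G\<^esub> B = B \<oplus>\<^bsub>G\<^esub> A"
    by (rule opmat_eqI) (simp_all add: opmat_apply cl add.commute)
  show "(A \<oplus>\<^bsub>G\<^esub> B) \<otimes>\<^bsub>G\<^esub> C = A \<otimes>\<^bsub>G\<^esub> C \<oplus>\<^bsub>G\<^esub> B \<otimes>\<^bsub>G\<^esub> C"
    by (rule opmat_eqI)
       (simp_all add: opmat_apply cl sum.distrib[symmetric] entry_closed[OF ABC(3)])
  show "C \<otimes>\<^bsub>G\<^esub> (A \<oplus>\<^bsub>G\<^esub> B) = C \<otimes>\<^bsub>G\<^esub> A \<oplus>\<^bsub>G\<^esub> C \<otimes>\<^bsub>G\<^esub> B"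
    by (rule opmat_eqI)
       (simp_all add: opmat_apply cl sum.distrib[symmetric] entry_closed entry_add)
  show "A \<otimes>\<^bsub>G\<^esub> B \<otimes>\<^bsub>G\<^esub> C = A \<otimes>\<^bsub>G\<^esub> (B \<otimes>\<^bsub>G\<^esub> C)"
  proof (rule opmat_eqI)
    fix p q h assume pq: "p \<in> {1..n}" "q \<in> {1..n}" "h \<in> H q"
    have "A p r (\<Sum>s\<in>{1..n}. B r s (C s q h)) = (\<Sum>s\<in>{1..n}. A p r (B r s (C s q h)))"
      if r: "r \<in> {1..n}" for r
      using r pq ABC
      by (intro linear_from_sum[OF sub[OF r] entry_linear]) (simp_all add: entry_closed)
    then have "(\<Sum>r\<in>{1..n}. A p r (\<Sum>s\<in>{1..n}. B r s (C s q h)))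
        = (\<Sum>r\<in>{1..n}. \<Sum>s\<in>{1..n}. A p r (B r s (C s q h)))" by simp
    also have "\<dots> = (\<Sum>s\<in>{1..n}. \<Sum>r\<in>{1..n}. A p r (B r s (C s q h)))" by (rule sum.swap)
    finally show "(A \<otimes>\<^bsub>G\<^esub> B \<otimes>\<^bsub>G\<^esub> C) p q h = (A \<otimes>\<^bsub>G\<^esub> (B \<otimes>\<^bsub>G\<^esub> C)) p q h"
      using pq ABC by (simp add: opmat_apply entry_closed)
  qed (simp_all add: cl)
next
  fix A assume A: "A \<in> carrier G"
  note cl = A add_closed mult_closed one_zero_closed
  show "\<zero>\<^bsub>G\<^esub> \<oplus>\<^bsub>G\<^esub> A = A" by (rule opmat_eqI) (simp_all add: opmat_apply cl)
  show "\<one>\<^bsub>G\<^esub> \<otimes>\<^bsub>G\<^esub> A = A"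
    by (rule opmat_eqI) (simp_all add: opmat_apply cl entry_closed)
  show "A \<otimes>\<^bsub>G\<^esub> \<one>\<^bsub>G\<^esub> = A"
  proof (rule opmat_eqI)
    fix p q h assume pq: "p \<in> {1..n}" "q \<in> {1..n}" "h \<in> H q"
    have "(A \<otimes>\<^bsub>G\<^esub> \<one>\<^bsub>G\<^esub>) p q h = (\<Sum>r\<in>{1..n}. if r = q then A p q h else 0)"
      using pq unfolding opmat_apply(1)[OF pq]
      by (intro sum.cong) (auto simp: opmat_apply entry_zero[OF A])
    then show "(A \<otimes>\<^bsub>G\<^esub> \<one>\<^bsub>G\<^esub>) p q h = A p q h" using pq by simp
  qed (simp_all add: cl)
  show "\<exists>B\<in>carrier G. B \<oplus>\<^bsub>G\<^esub> A = \<zero>\<^bsub>G\<^esub>" by (rule neg_exists[OF A])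
qed (simp_all add: add_closed mult_closed one_zero_closed)

text \<open>
  Every further factor pushes the nonzero entries one more diagonal below the main one; after \<open>n\<close>
  factors the band lies outside the matrix.
\<close>

lemma strictly_lower_triangular_nilpotent:
  assumes A: "A \<in> carrier G"
    and low: "\<And>p q h. \<lbrakk>p \<in> {1..n}; q \<in> {1..n}; h \<in> H q; p \<le> q\<rbrakk> \<Longrightarrow> A p q h = 0"
  shows "A [^]\<^bsub>G\<^esub> n = \<zero>\<^bsub>G\<^esub>"
proof -
  have band: "(A [^]\<^bsub>G\<^esub> k) p q h = 0"
    if "p \<in> {1..n}" "q \<in> {1..n}" "h \<in> H q" "p < q + k" for p q h k
    using that
  proof (induction k arbitrary: q h)
    case 0
    then show ?case by (simp add: opmat_apply)
  next
    case (Suc k)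
    have "(A [^]\<^bsub>G\<^esub> k) p r (A r q h) = 0" if r: "r \<in> {1..n}" for r
    proof (cases "r \<le> q")
      case True
      then show ?thesis using low[OF r] Suc.prems r A by (simp add: entry_zero)
    next
      case False
      then show ?thesis using Suc.prems r A by (intro Suc.IH) (simp_all add: entry_closed)
    qed
    then show ?case using Suc.prems by (simp add: opmat_apply)
  qed
  show ?thesis
    by (rule opmat_eqI) (use A in \<open>auto simp: opmat_apply intro!: band\<close>)
qed

lemma diagonal_mult_apply:
  assumes A: "A \<in> carrier G" and pq: "p \<in> {1..n}" "q \<in> {1..n}" "h \<in> H q"
    and c: "\<And>p q. p \<noteq> q \<Longrightarrow> c p q = 0"
  shows "(scalar_opmat n H c \<otimes>\<^bsub>G\<^esub> A) p q h = cscale (c p p) (A p q h)"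
    and "(A \<otimes>\<^bsub>G\<^esub> scalar_opmat n H c) p q h = cscale (c q q) (A p q h)"
proof -
  have "(scalar_opmat n H c \<otimes>\<^bsub>G\<^esub> A) p q h
      = (\<Sum>r\<in>{1..n}. if r = p then cscale (c p p) (A p q h) else 0)"
    unfolding opmat_apply(1)[OF pq] using pq
    by (intro sum.cong) (auto simp: scalar_opmat_def entry_closed[OF A] c)
  then show "(scalar_opmat n H c \<otimes>\<^bsub>G\<^esub> A) p q h = cscale (c p p) (A p q h)"
    using pq by simp
  have "(A \<otimes>\<^bsub>G\<^esub> scalar_opmat n H c) p q h
      = (\<Sum>r\<in>{1..n}. if r = q then cscale (c q q) (A p q h) else 0)"
    unfolding opmat_apply(1)[OF pq] using pq
    by (intro sum.cong) (auto simp: scalar_opmat_def c entry_zero[OF A] entry_scale[OF A])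
  then show "(A \<otimes>\<^bsub>G\<^esub> scalar_opmat n H c) p q h = cscale (c q q) (A p q h)"
    using pq by simp
qed

lemma compression_apply:
  assumes A: "A \<in> carrier G" and pq: "p \<in> {1..n}" "q \<in> {1..n}" "h \<in> H q"
    and c: "\<And>p q. p \<noteq> q \<Longrightarrow> c p q = 0" and d: "\<And>p q. p \<noteq> q \<Longrightarrow> d p q = 0"
  shows "(scalar_opmat n H c \<otimes>\<^bsub>G\<^esub> A \<otimes>\<^bsub>G\<^esub> scalar_opmat n H d) p q h
    = cscale (c p p * d q q) (A p q h)"
  using A pq c d
  by (simp add: diagonal_mult_apply scalar_opmat_closed mult.commute)

end

section \<open>Linearity of the local solution operators\<close>

text \<open>
  The combination is required only on \<open>U\<close>, so that the lemma can be iterated: first derivatives are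
  known to be additive inside the strip only, which suffices because the difference quotient at \<open>x\<close>
  stays in the open set \<open>U\<close>.
\<close>

lemma partial_deriv_linear:
  assumes U: "open U" "x \<in> U" and eq: "\<And>y. y \<in> U \<Longrightarrow> w y = a * u y + b * v y"
    and u: "(\<lambda>t. u (x + t *\<^sub>R axis j 1)) differentiable (at 0)"
    and v: "(\<lambda>t. v (x + t *\<^sub>R axis j 1)) differentiable (at 0)"
  shows "partial_deriv j w x = a * partial_deriv j u x + b * partial_deriv j v x"
proof -
  let ?S = "(\<lambda>t::real. x + t *\<^sub>R axis j 1) -` U"
  have S: "open ?S" by (intro open_vimage U continuous_intros)
  have "((\<lambda>t. a * u (x + t *\<^sub>R axis j 1) + b * v (x + t *\<^sub>R axis j 1)) has_vector_derivative
      a * partial_deriv j u x + b * partial_deriv j v x) (at 0)"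
    using u v unfolding partial_deriv_def
    by (intro has_vector_derivative_add has_vector_derivative_mult_right)
       (simp_all add: vector_derivative_works)
  then have "((\<lambda>t. w (x + t *\<^sub>R axis j 1)) has_vector_derivative
      a * partial_deriv j u x + b * partial_deriv j v x) (at 0)"
    by (rule has_vector_derivative_transform_within_open[OF _ S]) (use U eq in auto)
  then show ?thesis unfolding partial_deriv_def by (rule vector_derivative_at)
qed

lemma laplacian_linear:
  assumes U: "open U" "x \<in> U" and u: "C2_on U u" and v: "C2_on U v"
  shows "laplacian (cscale a u + cscale b v) x = a * laplacian u x + b * laplacian v x"
proof -
  have "partial_deriv j (cscale a u + cscale b v) y = a * partial_deriv j u y + b * partial_deriv j v y"
    if "y \<in> U" for j y
    using u v that by (intro partial_deriv_linear[OF U(1)]) (auto simp: C2_on_def C1_on_def cscale_def plus_fun_apply)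
  then have "partial_deriv j (partial_deriv j (cscale a u + cscale b v)) x
      = a * partial_deriv j (partial_deriv j u) x + b * partial_deriv j (partial_deriv j v) x" for j
    using u v U(2) by (intro partial_deriv_linear[OF U]) (auto simp: C2_on_def C1_on_def)
  then show ?thesis
    unfolding laplacian_def by (simp add: sum.distrib sum_distrib_left)
qed

lemma linear_from_combination:
  assumes "cfun.subspace V" "linear_from V T" "u \<in> V" "v \<in> V"
  shows "T (cscale a u + cscale b v) = cscale a (T u) + cscale b (T v)"
  using assms unfolding linear_from_def by (metis cfun.subspace_scale)

lemma linear_fromI:
  assumes "\<And>a b u v. \<lbrakk>u \<in> V; v \<in> V\<rbrakk> \<Longrightarrow> T (cscale a u + cscale b v) = cscale a (T u) + cscale b (T v)"
  shows "linear_from V T"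
  unfolding linear_from_def
proof (intro conjI ballI allI)
  fix u v assume "u \<in> V" "v \<in> V"
  then show "T (u + v) = T u + T v" using assms[of u v 1 1] by simp
next
  fix c v assume "v \<in> V"
  then show "T (cscale c v) = cscale c (T v)" using assms[of v v c 0] by simp
qed

locale strip_decomposition =
  fixes D :: strip_data
  assumes problem: "strip_problem D"
begin

abbreviation "N \<equiv> nstrips D"

lemma N_ge_2: "2 \<le> N"
  using problem by (simp add: strip_problem_def strip_geometry_def)

definition admissible :: "nat \<Rightarrow> cfun \<Rightarrow> cfun \<Rightarrow> bool" where
  "admissible i hl hr \<longleftrightarrow>
     (has_interface D i Lft \<longrightarrow> hl \<in> data_space D i Lft) \<and>
     (has_interface D i Rgt \<longrightarrow> hr \<in> data_space D i Rgt)"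

lemma data_subspace: "has_interface D i s \<Longrightarrow> cfun.subspace (data_space D i s)"
  using problem by (auto simp: strip_problem_def strip_spaces_def)

lemma local_subspace: "i \<in> {1..N} \<Longrightarrow> cfun.subspace (local_space D i)"
  using problem by (auto simp: strip_problem_def strip_spaces_def)

lemma local_sol_unique:
  assumes "i \<in> {1..N}" "admissible i hl hr"
  shows "\<exists>!v. is_local_solution D i hl hr 0 v"
proof -
  have "0 \<in> source_space D i"
    using problem assms by (auto simp: strip_problem_def strip_spaces_def intro: cfun.subspace_0)
  then show ?thesis
    using problem assms unfolding strip_problem_def locally_well_posed_def admissible_def by blast
qed

lemma local_sol_solves:
  assumes "i \<in> {1..N}" "admissible i hl hr"
  shows "is_local_solution D i hl hr 0 (local_sol D i hl hr 0)"
  unfolding local_sol_def by (rule theI'[OF local_sol_unique[OF assms]])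

lemma local_sol_in_space:
  assumes "i \<in> {1..N}" "admissible i hl hr"
  shows "local_sol D i hl hr 0 \<in> local_space D i"
  using local_sol_solves[OF assms] by (simp add: is_local_solution_def)

lemma admissible_combination:
  assumes "admissible i hl hr" "admissible i hl' hr'"
  shows "admissible i (cscale a hl + cscale b hl') (cscale a hr + cscale b hr')"
  using assms data_subspace unfolding admissible_def
  by (blast intro: cfun.subspace_add cfun.subspace_scale)

text \<open>
  The combination of the two solutions solves the problem with the combined data, and there is no
  other solution.
\<close>

lemma local_sol_linear:
  assumes i: "i \<in> {1..N}" and h: "admissible i hl hr" and h': "admissible i hl' hr'"
  shows "local_sol D i (cscale a hl + cscale b hl') (cscale a hr + cscale b hr') 0
    = cscale a (local_sol D i hl hr 0) + cscale b (local_sol D i hl' hr' 0)"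
proof -
  define u where "u = local_sol D i hl hr 0"
  define v where "v = local_sol D i hl' hr' 0"
  have u: "is_local_solution D i hl hr 0 u" and v: "is_local_solution D i hl' hr' 0 v"
    using local_sol_solves i h h' by (simp_all add: u_def v_def)
  have uV: "u \<in> local_space D i" and vV: "v \<in> local_space D i"
    using u v by (simp_all add: is_local_solution_def)
  note V = local_subspace[OF i]
  have open_i: "open (strip D i)"
    using problem i by (simp add: strip_problem_def strip_geometry_def)
  have C2: "C2_on (strip D i) u" "C2_on (strip D i) v"
    using problem i uV vV by (auto simp: strip_problem_def strip_spaces_def)
  have bc: "linear_from (local_space D i) (phys_bc D i)"
    using problem i by (auto simp: strip_problem_def strip_spaces_def)
  have io: "linear_from (local_space D i) (iop D i s)" if "has_interface D i s" for s
    using problem that by (auto simp: strip_problem_def strip_spaces_def)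
  have "is_local_solution D i (cscale a hl + cscale b hl') (cscale a hr + cscale b hr') 0
      (cscale a u + cscale b v)"
    unfolding is_local_solution_def
  proof (intro conjI ballI impI)
    show "cscale a u + cscale b v \<in> local_space D i"
      using V uV vV by (blast intro: cfun.subspace_add cfun.subspace_scale)
    show "phys_bc D i (cscale a u + cscale b v) = 0"
      using linear_from_combination[OF V bc uV vV] u v by (simp add: is_local_solution_def)
  next
    fix x assume x: "x \<in> strip D i"
    let ?k = "(wavenumber D)\<^sup>2"
    have eqs: "- ?k * u x - laplacian u x = 0" "- ?k * v x - laplacian v x = 0"
      using u v x by (simp_all add: is_local_solution_def zero_fun_apply)
    have "- ?k * (cscale a u + cscale b v) x - laplacian (cscale a u + cscale b v) x
      = a * (- ?k * u x - laplacian u x) + b * (- ?k * v x - laplacian v x)"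
      using laplacian_linear[OF open_i x C2] by (simp add: cscale_def algebra_simps plus_fun_apply)
    then show "- ?k * (cscale a u + cscale b v) x - laplacian (cscale a u + cscale b v) x
        = (0::cfun) x"
      unfolding eqs by (simp add: zero_fun_apply)
  next
    assume "2 \<le> i"
    then show "iop D i Lft (cscale a u + cscale b v) = cscale a hl + cscale b hl'"
      using linear_from_combination[OF V io uV vV, of Lft] u v i
      by (simp add: is_local_solution_def has_interface_def)
  next
    assume "i \<le> N - 1"
    then show "iop D i Rgt (cscale a u + cscale b v) = cscale a hr + cscale b hr'"
      using linear_from_combination[OF V io uV vV, of Rgt] u v i
      by (simp add: is_local_solution_def has_interface_def)
  qed
  then show ?thesis
    using local_sol_unique[OF i admissible_combination[OF h h']]
      local_sol_solves[OF i admissible_combination[OF h h']]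
    unfolding u_def v_def by blast
qed

lemma admissible_single:
  assumes "has_interface D i s" "h \<in> data_space D i s"
  shows "s = Lft \<Longrightarrow> admissible i h 0" "s = Rgt \<Longrightarrow> admissible i 0 h"
  using assms data_subspace cfun.subspace_0 unfolding admissible_def by blast+

lemma interface_trace:
  assumes "has_interface D j s" "i = neighbour j s" "i \<in> {1..N}"
  shows "v \<in> local_space D i \<Longrightarrow> iop D j s v \<in> data_space D j s"
    and "linear_from (local_space D i) (iop D j s)"
  using problem assms by (auto simp: strip_problem_def strip_spaces_def Pi_iff)

text \<open>
  A nonzero entry takes data on an interface of strip \<open>i\<close>, solves in that strip and takes the trace
  on an interface of a strip \<open>j\<close> which lies in the closure of strip \<open>i\<close>. All four cases of the
  definition have this form, with \<open>i\<close> the neighbour of \<open>j\<close> across the target interface.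
\<close>

lemma T_entry_closed_linear:
  assumes j: "has_interface D j s" and i: "has_interface D i t"
    and h: "h \<in> data_space D i t" and h': "h' \<in> data_space D i t"
  shows "T_entry D (j, s) (i, t) h \<in> data_space D j s \<and>
    T_entry D (j, s) (i, t) (cscale a h + cscale b h')
      = cscale a (T_entry D (j, s) (i, t) h) + cscale b (T_entry D (j, s) (i, t) h')"
proof (cases "i = neighbour j s")
  case True
  have iN: "i \<in> {1..N}" using i N_ge_2 by (auto simp: has_interface_def split: side.splits)
  note tr = interface_trace[OF j True iN] and V = local_subspace[OF iN]
  define sol where "sol g = (case t of Lft \<Rightarrow> local_sol D i g 0 0 | Rgt \<Rightarrow> local_sol D i 0 g 0)" for g
  have T: "T_entry D (j, s) (i, t) g = iop D j s (sol g)" for g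
    using True i j by (cases s; cases t) (auto simp: has_interface_def sol_def)
  have "sol g \<in> local_space D i" if "g \<in> data_space D i t" for g
    using that i iN by (cases t) (auto simp: sol_def intro!: local_sol_in_space admissible_single)
  moreover have "sol (cscale a h + cscale b h') = cscale a (sol h) + cscale b (sol h')"
    using local_sol_linear[OF iN admissible_single(1)[OF i h] admissible_single(1)[OF i h'], of a b]
      local_sol_linear[OF iN admissible_single(2)[OF i h] admissible_single(2)[OF i h'], of a b]
    by (cases t) (simp_all add: sol_def)
  ultimately show ?thesis
    using h h' tr(1) linear_from_combination[OF V tr(2)] by (simp add: T)
next
  case False
  then have "T_entry D (j, s) (i, t) g = 0" for g
    using j by (cases s; cases t) (auto simp: has_interface_def)
  then show ?thesis using cfun.subspace_0[OF data_subspace[OF j]] by simp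
qed

section \<open>The substructured operator\<close>

lemma label_has_interface:
  assumes "p \<in> {1..lr_size D}" "lr_label N p = (i, s)"
  shows "has_interface D i s" "lr_space D p = data_space D i s"
  using assms N_ge_2
  by (auto simp: lr_label_def has_interface_def lr_size_def lr_space_def split: if_splits)

sublocale operator_matrices "lr_size D" "lr_space D"
proof
  fix p assume "p \<in> {1..lr_size D}"
  then show "cfun.subspace (lr_space D p)"
    using label_has_interface data_subspace by (cases "lr_label N p") metis
qed

lemma T_LR_closed: "T_LR D \<in> carrier (LR D)"
  unfolding T_LR_def LR_def
proof (rule mk_opmat_closedI)
  fix p q assume pq: "p \<in> {1..lr_size D}" "q \<in> {1..lr_size D}"
  obtain j s where js: "lr_label N p = (j, s)" by fastforce
  obtain i t where it: "lr_label N q = (i, t)" by fastforce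
  note facts = label_has_interface[OF pq(1) js] label_has_interface[OF pq(2) it]
  note T = T_entry_closed_linear[OF facts(1) facts(3)]
  show "linear_from (lr_space D q) (T_entry D (lr_label N p) (lr_label N q))"
    using T by (intro linear_fromI) (auto simp: js it facts)
  fix h assume "h \<in> lr_space D q"
  then show "T_entry D (lr_label N p) (lr_label N q) h \<in> lr_space D p"
    using T by (auto simp: js it facts)
qed

text \<open>
  Left data pass from strip \<open>i\<close> to \<open>i + 1\<close> and right data from \<open>i\<close> to \<open>i - 1\<close>. The right interfaces
  are numbered backwards, so both transfers increase the position by one.
\<close>

lemma T_LR_same_side_strictly_lower:
  assumes "p \<in> {1..lr_size D}" "q \<in> {1..lr_size D}" "h \<in> lr_space D q" "p \<le> q"
    and "p \<le> N - 1 \<longleftrightarrow> q \<le> N - 1"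
  shows "T_LR D p q h = 0"
  using assms by (auto simp: T_LR_def lr_label_def lr_size_def)

definition proj_l :: "nat \<Rightarrow> nat \<Rightarrow> cfun \<Rightarrow> cfun" where "proj_l = LR_scalar D (I_l D)"
definition proj_r :: "nat \<Rightarrow> nat \<Rightarrow> cfun \<Rightarrow> cfun" where "proj_r = LR_scalar D (I_r D)"

lemma I_lr_off_diagonal: "p \<noteq> q \<Longrightarrow> I_l D p q = 0" "p \<noteq> q \<Longrightarrow> I_r D p q = 0"
  by (simp_all add: I_l_def I_r_def)

lemma transp_I: "transp (I_l D) = I_l D" "transp (I_r D) = I_r D"
  by (auto simp: transp_def I_l_def I_r_def fun_eq_iff)

lemma proj_closed: "proj_l \<in> carrier (LR D)" "proj_r \<in> carrier (LR D)"
  unfolding proj_l_def proj_r_def LR_def LR_scalar_def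
  by (auto intro!: scalar_opmat_closed simp: I_lr_off_diagonal)

lemma proj_complementary:
  "proj_l \<oplus>\<^bsub>LR D\<^esub> proj_r = \<one>\<^bsub>LR D\<^esub>" "proj_l \<otimes>\<^bsub>LR D\<^esub> proj_r = \<zero>\<^bsub>LR D\<^esub>" "proj_r \<otimes>\<^bsub>LR D\<^esub> proj_l = \<zero>\<^bsub>LR D\<^esub>"
proof -
  note cl = proj_closed[unfolded LR_def]
  have proj_l: "proj_l p q h = cscale (I_l D p q) h" and proj_r: "proj_r p q h = cscale (I_r D p q) h"
    if "p \<in> {1..lr_size D}" "q \<in> {1..lr_size D}" "h \<in> lr_space D q" for p q h
    using that by (simp_all add: proj_l_def proj_r_def LR_scalar_def scalar_opmat_def)
  show "proj_l \<oplus>\<^bsub>LR D\<^esub> proj_r = \<one>\<^bsub>LR D\<^esub>" unfolding LR_def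
    by (rule opmat_eqI)
       (auto simp: cl opmat_apply proj_l proj_r I_l_def I_r_def, simp add: lr_size_def)
  have "(proj_l \<otimes>\<^bsub>G\<^esub> proj_r) p q h = 0" "(proj_r \<otimes>\<^bsub>G\<^esub> proj_l) p q h = 0"
    if "p \<in> {1..lr_size D}" "q \<in> {1..lr_size D}" "h \<in> lr_space D q" for p q h
    using diagonal_mult_apply(1)[OF cl(2) that, of "I_l D"]
      diagonal_mult_apply(1)[OF cl(1) that, of "I_r D"] that N_ge_2
    by (auto simp: proj_l proj_r I_l_def I_r_def simp flip: proj_l_def[unfolded LR_scalar_def] proj_r_def[unfolded LR_scalar_def])
  then show "proj_l \<otimes>\<^bsub>LR D\<^esub> proj_r = \<zero>\<^bsub>LR D\<^esub>" "proj_r \<otimes>\<^bsub>LR D\<^esub> proj_l = \<zero>\<^bsub>LR D\<^esub>" unfolding LR_def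
    by (auto intro!: opmat_eqI simp: cl opmat_apply(4))
qed

lemma blocks:
  "M_l D = proj_l \<otimes>\<^bsub>LR D\<^esub> T_LR D \<otimes>\<^bsub>LR D\<^esub> proj_l" "A_l D = proj_l \<otimes>\<^bsub>LR D\<^esub> T_LR D \<otimes>\<^bsub>LR D\<^esub> proj_r"
  "M_r D = proj_r \<otimes>\<^bsub>LR D\<^esub> T_LR D \<otimes>\<^bsub>LR D\<^esub> proj_r" "A_r D = proj_r \<otimes>\<^bsub>LR D\<^esub> T_LR D \<otimes>\<^bsub>LR D\<^esub> proj_l"
  by (simp_all add: M_l_def A_l_def M_r_def A_r_def proj_l_def proj_r_def transp_I)

lemma one_minus_M_Units:
  "\<one>\<^bsub>LR D\<^esub> \<ominus>\<^bsub>LR D\<^esub> M_l D \<in> Units (LR D)" "\<one>\<^bsub>LR D\<^esub> \<ominus>\<^bsub>LR D\<^esub> M_r D \<in> Units (LR D)"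
proof -
  note cl = proj_closed[unfolded LR_def] T_LR_closed[unfolded LR_def]
  have left_block: "(proj_l \<otimes>\<^bsub>G\<^esub> T_LR D \<otimes>\<^bsub>G\<^esub> proj_l) p q h = cscale (I_l D p p * I_l D q q) (T_LR D p q h)"
    and right_block: "(proj_r \<otimes>\<^bsub>G\<^esub> T_LR D \<otimes>\<^bsub>G\<^esub> proj_r) p q h = cscale (I_r D p p * I_r D q q) (T_LR D p q h)"
    if "p \<in> {1..lr_size D}" "q \<in> {1..lr_size D}" "h \<in> lr_space D q" for p q h
    unfolding proj_l_def proj_r_def LR_scalar_def
    by (intro compression_apply cl(3) that I_lr_off_diagonal; assumption)+
  have same: "T_LR D p q h = 0"
    if "p \<in> {1..lr_size D}" "q \<in> {1..lr_size D}" "h \<in> lr_space D q" "p \<le> q"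
      "I_l D p p * I_l D q q \<noteq> 0 \<or> I_r D p p * I_r D q q \<noteq> 0" for p q h
    using that N_ge_2
    by (intro T_LR_same_side_strictly_lower) (auto simp: I_l_def I_r_def split: if_splits)
  have "(proj_l \<otimes>\<^bsub>G\<^esub> T_LR D \<otimes>\<^bsub>G\<^esub> proj_l) [^]\<^bsub>G\<^esub> lr_size D = \<zero>\<^bsub>G\<^esub>"
    "(proj_r \<otimes>\<^bsub>G\<^esub> T_LR D \<otimes>\<^bsub>G\<^esub> proj_r) [^]\<^bsub>G\<^esub> lr_size D = \<zero>\<^bsub>G\<^esub>"
    using same cl
    by (intro strictly_lower_triangular_nilpotent; force simp: left_block right_block)+
  then show "\<one>\<^bsub>LR D\<^esub> \<ominus>\<^bsub>LR D\<^esub> M_l D \<in> Units (LR D)" "\<one>\<^bsub>LR D\<^esub> \<ominus>\<^bsub>LR D\<^esub> M_r D \<in> Units (LR D)"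
    using cl unfolding blocks LR_def by (auto intro!: one_minus_nilpotent_Unit)
qed

lemma ring_LR: "ring (LR D)"
  unfolding LR_def by (rule ring_axioms)

lemma T_LR_split:
  "T_LR D = (M_l D \<oplus>\<^bsub>LR D\<^esub> A_l D) \<oplus>\<^bsub>LR D\<^esub> (M_r D \<oplus>\<^bsub>LR D\<^esub> A_r D)"
proof -
  interpret LR: ring "LR D" by (rule ring_LR)
  note cl = proj_closed T_LR_closed
  have add: "X \<otimes>\<^bsub>LR D\<^esub> proj_l \<oplus>\<^bsub>LR D\<^esub> X \<otimes>\<^bsub>LR D\<^esub> proj_r = X" if "X \<in> carrier (LR D)" for X
    using that cl proj_complementary(1) by (metis LR.r_distr LR.r_one)
  have "(M_l D \<oplus>\<^bsub>LR D\<^esub> A_l D) \<oplus>\<^bsub>LR D\<^esub> (M_r D \<oplus>\<^bsub>LR D\<^esub> A_r D)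
      = proj_l \<otimes>\<^bsub>LR D\<^esub> T_LR D \<oplus>\<^bsub>LR D\<^esub> proj_r \<otimes>\<^bsub>LR D\<^esub> T_LR D"
    using add[of "proj_l \<otimes>\<^bsub>LR D\<^esub> T_LR D"] add[of "proj_r \<otimes>\<^bsub>LR D\<^esub> T_LR D"] cl
    by (simp add: blocks LR.a_comm[of "proj_r \<otimes>\<^bsub>LR D\<^esub> T_LR D \<otimes>\<^bsub>LR D\<^esub> proj_r"])
  also have "\<dots> = T_LR D"
    using cl proj_complementary(1) by (metis LR.l_distr LR.l_one)
  finally show ?thesis by simp
qed

lemma block_products:
  "A_l D \<otimes>\<^bsub>LR D\<^esub> M_l D = \<zero>\<^bsub>LR D\<^esub>" "A_l D \<otimes>\<^bsub>LR D\<^esub> A_l D = \<zero>\<^bsub>LR D\<^esub>"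
  "A_r D \<otimes>\<^bsub>LR D\<^esub> M_r D = \<zero>\<^bsub>LR D\<^esub>" "A_r D \<otimes>\<^bsub>LR D\<^esub> A_r D = \<zero>\<^bsub>LR D\<^esub>"
  "M_l D \<otimes>\<^bsub>LR D\<^esub> M_r D = \<zero>\<^bsub>LR D\<^esub>" "M_l D \<otimes>\<^bsub>LR D\<^esub> A_r D = \<zero>\<^bsub>LR D\<^esub>"
  "M_r D \<otimes>\<^bsub>LR D\<^esub> M_l D = \<zero>\<^bsub>LR D\<^esub>" "M_r D \<otimes>\<^bsub>LR D\<^esub> A_l D = \<zero>\<^bsub>LR D\<^esub>"
proof -
  interpret LR: ring "LR D" by (rule ring_LR)
  note cl = proj_closed T_LR_closed
  have annihilate: "X \<otimes>\<^bsub>LR D\<^esub> E \<otimes>\<^bsub>LR D\<^esub> (F \<otimes>\<^bsub>LR D\<^esub> Y \<otimes>\<^bsub>LR D\<^esub> Z) = \<zero>\<^bsub>LR D\<^esub>"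
    if "E \<otimes>\<^bsub>LR D\<^esub> F = \<zero>\<^bsub>LR D\<^esub>" "X \<in> carrier (LR D)" "Y \<in> carrier (LR D)" "Z \<in> carrier (LR D)"
      "E \<in> carrier (LR D)" "F \<in> carrier (LR D)" for X Y Z E F
  proof -
    have "X \<otimes>\<^bsub>LR D\<^esub> E \<otimes>\<^bsub>LR D\<^esub> (F \<otimes>\<^bsub>LR D\<^esub> Y \<otimes>\<^bsub>LR D\<^esub> Z)
        = X \<otimes>\<^bsub>LR D\<^esub> (E \<otimes>\<^bsub>LR D\<^esub> F) \<otimes>\<^bsub>LR D\<^esub> Y \<otimes>\<^bsub>LR D\<^esub> Z"
      using that(2-) by (simp add: LR.m_assoc)
    then show ?thesis using that by simp
  qed
  note an = annihilate[OF proj_complementary(2)] annihilate[OF proj_complementary(3)]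
  show "A_l D \<otimes>\<^bsub>LR D\<^esub> M_l D = \<zero>\<^bsub>LR D\<^esub>" "A_l D \<otimes>\<^bsub>LR D\<^esub> A_l D = \<zero>\<^bsub>LR D\<^esub>"
    "A_r D \<otimes>\<^bsub>LR D\<^esub> M_r D = \<zero>\<^bsub>LR D\<^esub>" "A_r D \<otimes>\<^bsub>LR D\<^esub> A_r D = \<zero>\<^bsub>LR D\<^esub>"
    "M_l D \<otimes>\<^bsub>LR D\<^esub> M_r D = \<zero>\<^bsub>LR D\<^esub>" "M_l D \<otimes>\<^bsub>LR D\<^esub> A_r D = \<zero>\<^bsub>LR D\<^esub>"
    "M_r D \<otimes>\<^bsub>LR D\<^esub> M_l D = \<zero>\<^bsub>LR D\<^esub>" "M_r D \<otimes>\<^bsub>LR D\<^esub> A_l D = \<zero>\<^bsub>LR D\<^esub>"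
    unfolding blocks by (simp_all add: an cl)
qed

lemma blocks_closed:
  "M_l D \<in> carrier (LR D)" "A_l D \<in> carrier (LR D)"
  "M_r D \<in> carrier (LR D)" "A_r D \<in> carrier (LR D)"
  using proj_closed T_LR_closed unfolding blocks LR_def by auto

end

theorem proposition4p2:
  fixes D :: strip_data
  assumes "strip_problem D"
  shows "R_SGS D =
           (\<one>\<^bsub>LR D\<^esub> \<oplus>\<^bsub>LR D\<^esub> C_r D) \<otimes>\<^bsub>LR D\<^esub> C_l D \<otimes>\<^bsub>LR D\<^esub> (M_r D \<oplus>\<^bsub>LR D\<^esub> A_r D) \<and>
         (\<forall>n::nat. n \<ge> 1 \<longrightarrow>
           R_SGS D [^]\<^bsub>LR D\<^esub> n =
             (\<one>\<^bsub>LR D\<^esub> \<oplus>\<^bsub>LR D\<^esub> C_r D) \<otimes>\<^bsub>LR D\<^esub> C_l D \<otimes>\<^bsub>LR D\<^esub>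
             ((C_r D \<otimes>\<^bsub>LR D\<^esub> C_l D) [^]\<^bsub>LR D\<^esub> (n - 1)) \<otimes>\<^bsub>LR D\<^esub> (M_r D \<oplus>\<^bsub>LR D\<^esub> A_r D))"
proof -
  interpret strip_decomposition D using assms by unfold_locales
  interpret LR: ring "LR D" by (rule ring_LR)
  note sgs = LR.symmetric_gauss_seidel_error[OF blocks_closed block_products(1,2) one_minus_M_Units(1)
      block_products(3,4) one_minus_M_Units(2) block_products(5-8) C_l_def C_r_def T_LR_split
      R_SGS_def[unfolded M_inv_SGS_def]]
  show ?thesis using sgs by blast
qed

end
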